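(* Let $\omega=1$ and let $(\theta,\rho)$ be the solution of the flow (F) with admissible initial datum $(\theta_0,\rho_0)$. If $(\theta_0,\rho_0)$ describes a heterogeneous curve which is axially symmetric, then so does $(\theta(t,\cdot),\rho(t,\cdot))$ for all $t\in(0,\infty)$.
   Context: Fixed parameters: $L>0$, $\nu\in\mathbb{R}$, $\mu>0$, $\omega\in\mathbb{Z}$, $c_0\in\mathbb{R}$, and $\beta\in C^\infty(\mathbb{R})$ with $\beta>0$. A function $\theta:[0,L]\to\mathbb{R}$ is the inclination angle of the arc-length parametrized planar curve $\gamma(s)=\gamma(0)+\int_0^s(\cos\theta,\sin\theta)\,\mathrm{d}r$; $\rho:[0,L]\to\mathbb{R}$ is a density. The flow (F) is the initial boundary value problem $$\partial_t\theta=\partial_s\big(\beta(\rho)(\partial_s\theta-c_0)\big)+\lambda_{\theta1}\sin\theta-\lambda_{\theta2}\cos\theta,\qquad \partial_t\rho=\mu\,\partial_s^2\rho-\tfrac12\beta'(\rho)(\partial_s\theta-c_0)^2-\lambda_\rho$$ on $(0,T)\times[0,L]$, with boundary conditions $\theta(\cdot,L)-\theta(\cdot,0)=2\pi\omega$, $\rho(\cdot,L)=\rho(\cdot,0)$, $\partial_s\theta(\cdot,L)=\partial_s\theta(\cdot,0)$, $\partial_s\rho(\cdot,L)=\partial_s\rho(\cdot,0)$, and initial condition $(\theta,\rho)(0,\cdot)=(\theta_0,\rho_0)$. The nonlocal multipliers are $$\begin{pmatrix}\lambda_{\theta1}\\ \lambda_{\theta2}\end{pmatrix}(t)=\Pi^{-1}(\theta)\int_0^L\begin{pmatrix}\cos\theta\\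 \sin\theta\end{pmatrix}\partial_s\theta\,\beta(\rho)(\partial_s\theta-c_0)\,\mathrm{d}s,\quad \Pi(\theta)=\begin{pmatrix}\int_0^L\sin^2\theta\,\mathrm{d}s&-\int_0^L\cos\theta\sin\theta\,\mathrm{d}s\\-\int_0^L\cos\theta\sin\theta\,\mathrm{d}s&\int_0^L\cos^2\theta\,\mathrm{d}s\end{pmatrix},$$ $\lambda_\rho(t)=-\frac1{2L}\int_0^L\beta'(\rho)(\partial_s\theta-c_0)^2\,\mathrm{d}s$. An admissible initial datum is $(\theta_0,\rho_0)\in C^\infty([0,L])$ with $\int_0^L\rho_0\,\mathrm{d}s=\nu L$, $\int_0^L\sin\theta_0\,\mathrm{d}s=\int_0^L\cos\theta_0\,\mathrm{d}s=0$, $\theta_0(L)-\theta_0(0)=2\pi\omega$, $\rho_0(L)=\rho_0(0)$, and $\partial_s^j\theta_0(L)=\partial_s^j\theta_0(0)$, $\partial_s^j\rho_0(L)=\partial_s^j\rho_0(0)$ for $j=1,2$. By earlier work, for each admissible initial datum (F) has a unique global solution $(\theta,\rho)\in C^\infty((0,\infty)\times[0,L])\cap C^0([0,\infty);C^2([0,L]))$. Axial symmetry: the heterogeneous curve described by $(\theta,\rho)\in C^\infty([0,L])$ is axially symmetric if $(\partial_s\theta,\rho)(s)=(\partial_s\theta,\rho)(L-s)$ for all $s\in[0,L]$. *)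

theory Defs
  imports "HOL-Analysis.Analysis"
begin

text \<open>Derivatives with respect to \<open>s\<close> are taken within \<open>[0,L]\<close>, hence are one-sided at \<open>0\<close> and \<open>L\<close>.\<close>

definition arc_deriv :: "real \<Rightarrow> (real \<Rightarrow> real) \<Rightarrow> real \<Rightarrow> real" where
  "arc_deriv L f s = vector_derivative f (at s within {0..L})"

definition smooth_real :: "(real \<Rightarrow> real) \<Rightarrow> bool" where
  "smooth_real f \<longleftrightarrow> (\<forall>n. (deriv ^^ n) f differentiable_on UNIV)"

definition smooth_interval :: "real \<Rightarrow> (real \<Rightarrow> real) \<Rightarrow> bool" where
  "smooth_interval L f \<longleftrightarrow> (\<forall>n. (arc_deriv L ^^ n) f differentiable_on {0..L})"

definition partial_t :: "(real \<Rightarrow> real \<Rightarrow> real) \<Rightarrow> real \<Rightarrow> real \<Rightarrow> real" where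
  "partial_t f t s = deriv (\<lambda>r. f r s) t"

definition partial_s :: "real \<Rightarrow> (real \<Rightarrow> real \<Rightarrow> real) \<Rightarrow> real \<Rightarrow> real \<Rightarrow> real" where
  "partial_s L f t s = arc_deriv L (f t) s"

text \<open>All iterated partial derivatives of \<open>f(t,s)\<close>, in any order.\<close>

inductive_set partials :: "real \<Rightarrow> (real \<Rightarrow> real \<Rightarrow> real) \<Rightarrow> (real \<Rightarrow> real \<Rightarrow> real) set"
  for L :: real and f :: "real \<Rightarrow> real \<Rightarrow> real" where
  base: "f \<in> partials L f"
| time: "g \<in> partials L f \<Longrightarrow> partial_t g \<in> partials L f"
| space: "g \<in> partials L f \<Longrightarrow> partial_s L g \<in> partials L f"

text \<open>The class \<open>C\<^sup>\<infinity>((0,\<infinity>) \<times> [0,L])\<close>: the partial derivatives of all orders exist and are continuous.\<close>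

definition smooth_cylinder :: "real \<Rightarrow> (real \<Rightarrow> real \<Rightarrow> real) \<Rightarrow> bool" where
  "smooth_cylinder L f \<longleftrightarrow> (\<forall>g\<in>partials L f.
     continuous_on ({0<..} \<times> {0..L}) (\<lambda>(t, s). g t s) \<and>
     (\<forall>t>0. \<forall>s\<in>{0..L}. (\<lambda>r. g r s) differentiable (at t) \<and>
        g t differentiable (at s within {0..L})))"

definition C2_interval :: "real \<Rightarrow> (real \<Rightarrow> real) \<Rightarrow> bool" where
  "C2_interval L f \<longleftrightarrow>
     f differentiable_on {0..L} \<and> arc_deriv L f differentiable_on {0..L} \<and>
     continuous_on {0..L} ((arc_deriv L ^^ 2) f)"

text \<open>The class \<open>C\<^sup>0([0,\<infinity>); C\<^sup>2([0,L]))\<close>: convergence in the \<open>C\<^sup>2\<close> norm is uniform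
  convergence of the derivatives of order at most two.\<close>

definition continuous_into_C2 :: "real \<Rightarrow> (real \<Rightarrow> real \<Rightarrow> real) \<Rightarrow> bool" where
  "continuous_into_C2 L f \<longleftrightarrow> (\<forall>t\<ge>0. C2_interval L (f t) \<and>
     (\<forall>j\<le>2. uniform_limit {0..L} (\<lambda>r. (arc_deriv L ^^ j) (f r)) ((arc_deriv L ^^ j) (f t))
        (at t within {0..})))"

definition Pi_matrix :: "real \<Rightarrow> (real \<Rightarrow> real) \<Rightarrow> real^2^2" where
  "Pi_matrix L \<theta> = vector
     [vector [integral {0..L} (\<lambda>s. (sin (\<theta> s))\<^sup>2), - integral {0..L} (\<lambda>s. cos (\<theta> s) * sin (\<theta> s))],
      vector [- integral {0..L} (\<lambda>s. cos (\<theta> s) * sin (\<theta> s)), integral {0..L} (\<lambda>s. (cos (\<theta> s))\<^sup>2)]]"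

definition lambda_theta ::
  "real \<Rightarrow> real \<Rightarrow> (real \<Rightarrow> real) \<Rightarrow> (real \<Rightarrow> real) \<Rightarrow> (real \<Rightarrow> real) \<Rightarrow> real^2" where
  "lambda_theta L c0 \<beta> \<theta> \<rho> = matrix_inv (Pi_matrix L \<theta>) *v vector
     [integral {0..L} (\<lambda>s. cos (\<theta> s) * arc_deriv L \<theta> s * \<beta> (\<rho> s) * (arc_deriv L \<theta> s - c0)),
      integral {0..L} (\<lambda>s. sin (\<theta> s) * arc_deriv L \<theta> s * \<beta> (\<rho> s) * (arc_deriv L \<theta> s - c0))]"

definition lambda_rho ::
  "real \<Rightarrow> real \<Rightarrow> (real \<Rightarrow> real) \<Rightarrow> (real \<Rightarrow> real) \<Rightarrow> (real \<Rightarrow> real) \<Rightarrow> real" where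
  "lambda_rho L c0 \<beta> \<theta> \<rho> =
     - (1 / (2 * L)) * integral {0..L} (\<lambda>s. deriv \<beta> (\<rho> s) * (arc_deriv L \<theta> s - c0)\<^sup>2)"

definition admissible ::
  "real \<Rightarrow> real \<Rightarrow> int \<Rightarrow> (real \<Rightarrow> real) \<Rightarrow> (real \<Rightarrow> real) \<Rightarrow> bool" where
  "admissible L \<nu> \<omega> \<theta>0 \<rho>0 \<longleftrightarrow>
     smooth_interval L \<theta>0 \<and> smooth_interval L \<rho>0 \<and>
     integral {0..L} \<rho>0 = \<nu> * L \<and>
     integral {0..L} (\<lambda>s. sin (\<theta>0 s)) = 0 \<and> integral {0..L} (\<lambda>s. cos (\<theta>0 s)) = 0 \<and>
     \<theta>0 L - \<theta>0 0 = 2 * pi * of_int \<omega> \<and> \<rho>0 L = \<rho>0 0 \<and>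
     (\<forall>j\<in>{1, 2}. (arc_deriv L ^^ j) \<theta>0 L = (arc_deriv L ^^ j) \<theta>0 0 \<and>
        (arc_deriv L ^^ j) \<rho>0 L = (arc_deriv L ^^ j) \<rho>0 0)"

definition flow_solution ::
  "real \<Rightarrow> real \<Rightarrow> int \<Rightarrow> real \<Rightarrow> (real \<Rightarrow> real) \<Rightarrow> (real \<Rightarrow> real) \<Rightarrow> (real \<Rightarrow> real) \<Rightarrow>
   (real \<Rightarrow> real \<Rightarrow> real) \<Rightarrow> (real \<Rightarrow> real \<Rightarrow> real) \<Rightarrow> bool" where
  "flow_solution L \<mu> \<omega> c0 \<beta> \<theta>0 \<rho>0 \<theta> \<rho> \<longleftrightarrow>
     smooth_cylinder L \<theta> \<and> smooth_cylinder L \<rho> \<and>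
     continuous_into_C2 L \<theta> \<and> continuous_into_C2 L \<rho> \<and>
     (\<forall>t>0. \<forall>s\<in>{0..L}.
        partial_t \<theta> t s =
          arc_deriv L (\<lambda>r. \<beta> (\<rho> t r) * (arc_deriv L (\<theta> t) r - c0)) s
          + lambda_theta L c0 \<beta> (\<theta> t) (\<rho> t) $ 1 * sin (\<theta> t s)
          - lambda_theta L c0 \<beta> (\<theta> t) (\<rho> t) $ 2 * cos (\<theta> t s) \<and>
        partial_t \<rho> t s =
          \<mu> * (arc_deriv L ^^ 2) (\<rho> t) s
          - (1 / 2) * deriv \<beta> (\<rho> t s) * (arc_deriv L (\<theta> t) s - c0)\<^sup>2
          - lambda_rho L c0 \<beta> (\<theta> t) (\<rho> t)) \<and>
     (\<forall>t>0. \<theta> t L - \<theta> t 0 = 2 * pi * of_int \<omega> \<and> \<rho> t L = \<rho> t 0 \<and>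
        arc_deriv L (\<theta> t) L = arc_deriv L (\<theta> t) 0 \<and>
        arc_deriv L (\<rho> t) L = arc_deriv L (\<rho> t) 0) \<and>
     (\<forall>s\<in>{0..L}. \<theta> 0 s = \<theta>0 s \<and> \<rho> 0 s = \<rho>0 s)"

definition axially_symmetric :: "real \<Rightarrow> (real \<Rightarrow> real) \<Rightarrow> (real \<Rightarrow> real) \<Rightarrow> bool" where
  "axially_symmetric L \<theta> \<rho> \<longleftrightarrow>
     smooth_interval L \<theta> \<and> smooth_interval L \<rho> \<and>
     (\<forall>s\<in>{0..L}. arc_deriv L \<theta> s = arc_deriv L \<theta> (L - s) \<and> \<rho> s = \<rho> (L - s))"

end

theory Submission imports Defs begin

text \<open>Compare the solution with its reflection by an energy estimate. Since the initial datum is symmetric,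
  \<open>\<theta>(0,s) + \<theta>(0,L-s)\<close> is a constant \<open>2a\<close>. Put \<open>u(t,s) = \<theta>(t,s) + \<theta>(t,L-s) - 2a\<close> and
  \<open>v(t,s) = \<rho>(t,s) - \<rho>(t,L-s)\<close>; both vanish at \<open>t = 0\<close>. The multiplier \<open>\<lambda>\<^sub>\<rho>\<close> cancels in the equation for
  \<open>v\<close>. The multiplier \<open>\<lambda>\<^sub>\<theta>\<close> enters \<open>\<integral> u u\<^sub>t\<close> through the component \<open>\<lambda>\<^sub>\<theta>\<^sub>1 sin a - \<lambda>\<^sub>\<theta>\<^sub>2 cos a\<close> times a
  quantity that differs from \<open>\<integral> sin(\<theta>(s) - a) + sin(\<theta>(L-s) - a)\<close> by \<open>O(u\<^sup>2)\<close>, and the latter integral is zero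
  because the flow keeps the curve closed. So only boundedness of \<open>\<lambda>\<^sub>\<theta>\<close> up to \<open>t = 0\<close> is needed, which holds
  since \<open>\<theta>\<close> makes a full turn and hence \<open>det \<Pi>(\<theta>) > 0\<close>. Gronwall's lemma for \<open>\<integral> u\<^sup>2 + v\<^sup>2\<close> gives
  \<open>u = v = 0\<close>.\<close>

subsection \<open>One-sided derivatives and integrals on an interval\<close>

lemma arc_deriv_has_derivative:
  assumes "f differentiable (at s within {0..L})"
  shows "(f has_real_derivative arc_deriv L f s) (at s within {0..L})"
  using assms
  by (simp add: arc_deriv_def vector_derivative_works has_real_derivative_iff_has_vector_derivative)

lemma arc_deriv_unique:
  assumes "L > 0" "s \<in> {0..L}" "(f has_real_derivative d) (at s within {0..L})"
  shows "arc_deriv L f s = d"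
  using assms vector_derivative_within_closed_interval[of 0 L s f d]
  by (simp add: arc_deriv_def has_real_derivative_iff_has_vector_derivative)

lemma has_real_derivative_reflect:
  assumes "s \<in> {0..L}" "(f has_real_derivative d) (at (L - s) within {0..L})"
  shows "((\<lambda>r. f (L - r)) has_real_derivative - d) (at s within {0..L})"
proof -
  have "(\<lambda>r. L - r) ` {0..L} = {0..L}"
    by simp
  moreover have "((\<lambda>r. L - r) has_real_derivative - 1) (at s within {0..L})"
    by (auto intro!: derivative_eq_intros)
  ultimately have "(f \<circ> (\<lambda>r. L - r) has_real_derivative d * - 1) (at s within {0..L})"
    using assms(2) by (intro DERIV_image_chain) auto
  then show ?thesis by (simp add: o_def)
qed

lemma integral_reflect_interval:
  fixes f :: "real \<Rightarrow> real"
  assumes "(f has_integral i) {0..L}"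
  shows "((\<lambda>s. f (L - s)) has_integral i) {0..L}"
proof -
  have "((\<lambda>x. f (-1 *\<^sub>R x + L)) has_integral (1 / \<bar>-1\<bar> ^ DIM(real)) *\<^sub>R i)
      ((\<lambda>x. (1 / -1) *\<^sub>R x + -((1 / -1) *\<^sub>R L)) ` cbox 0 L)"
    by (rule has_integral_affinity) (use assms in auto)
  moreover have "(\<lambda>x. L - x) ` {0..L} = {0..L}"
    by simp
  ultimately show ?thesis by (simp add: algebra_simps)
qed

lemma has_integral_derivative:
  fixes f :: "real \<Rightarrow> real"
  assumes "a \<le> b" "\<And>x. x \<in> {a..b} \<Longrightarrow> (f has_real_derivative f' x) (at x within {a..b})"
  shows "(f' has_integral f b - f a) {a..b}"
  using assms by (intro fundamental_theorem_of_calculus)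
    (auto simp: has_real_derivative_iff_has_vector_derivative)

text \<open>The distance splits through \<open>g t x\<close>: uniform convergence controls the
  change of time, continuity of the slice \<open>g t\<close> the change of position.\<close>

lemma continuous_on_uniform_limit_cylinder:
  fixes g :: "real \<Rightarrow> real \<Rightarrow> real"
  assumes cont: "\<And>t. t \<in> T \<Longrightarrow> continuous_on S (g t)"
    and lim: "\<And>t. t \<in> T \<Longrightarrow> uniform_limit S g (g t) (at t within T)"
  shows "continuous_on (T \<times> S) (\<lambda>(t, s). g t s)"
proof (clarsimp simp: continuous_on_iff)
  fix t s and e :: real
  assume t: "t \<in> T" and s: "s \<in> S" and e: "e > 0"
  have "\<forall>\<^sub>F r in at t within T. \<forall>x\<in>S. dist (g r x) (g t x) < e / 2"
    using lim[OF t] half_gt_zero[OF e] unfolding uniform_limit_iff by blast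
  then obtain d1 where d1: "d1 > 0"
    "\<And>r x. \<lbrakk>r \<in> T; r \<noteq> t; dist r t < d1; x \<in> S\<rbrakk> \<Longrightarrow> dist (g r x) (g t x) < e / 2"
    by (auto simp: eventually_at)
  obtain d2 where d2: "d2 > 0" "\<And>x. \<lbrakk>x \<in> S; dist x s < d2\<rbrakk> \<Longrightarrow> dist (g t x) (g t s) < e / 2"
    using cont[OF t] s e by (meson continuous_on_iff half_gt_zero)
  show "\<exists>d>0. \<forall>r\<in>T. \<forall>x\<in>S. dist (r, x) (t, s) < d \<longrightarrow> dist (g r x) (g t s) < e"
  proof (intro exI conjI ballI impI)
    show "min d1 d2 > 0" using d1 d2 by simp
  next
    fix r x assume r: "r \<in> T" and x: "x \<in> S" and d: "dist (r, x) (t, s) < min d1 d2"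
    have "dist r t < d1" "dist x s < d2"
      using d dist_fst_le[of "(r, x)" "(t, s)"] dist_snd_le[of "(r, x)" "(t, s)"] by auto
    then have "dist (g r x) (g t x) < e / 2" "dist (g t x) (g t s) < e / 2"
      using d1 d2 r x e by (cases "r = t"; auto)+
    then show "dist (g r x) (g t s) < e"
      by (metis dist_commute dist_triangle_half_l)
  qed
qed

text \<open>The integrating factor \<open>exp (- C * t)\<close> makes the product nonincreasing. At
  time 0 only continuity is asked, because the flow equations hold for positive times only.\<close>

lemma gronwall_zero:
  fixes E E' :: "real \<Rightarrow> real"
  assumes "T > 0" "continuous_on {0..T} E" "E 0 = 0"
    and deriv: "\<And>t. \<lbrakk>0 < t; t < T\<rbrakk> \<Longrightarrow> (E has_real_derivative E' t) (at t)"
    and bound: "\<And>t. \<lbrakk>0 < t; t < T\<rbrakk> \<Longrightarrow> E' t \<le> C * E t"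
  shows "E T \<le> 0"
proof -
  let ?f = "\<lambda>t. exp (- C * t) * E t"
  have "?f T \<le> ?f 0"
  proof (rule DERIV_nonpos_imp_decreasing_open[of 0 T ?f])
    fix t assume t: "0 < t" "t < T"
    have "(?f has_real_derivative exp (- C * t) * (E' t - C * E t)) (at t)"
      by (rule derivative_eq_intros deriv[OF t] refl | simp add: algebra_simps)+
    moreover have "exp (- C * t) * (E' t - C * E t) \<le> 0"
      using bound[OF t] by (simp add: mult_nonneg_nonpos)
    ultimately show "\<exists>y. (?f has_real_derivative y) (at t) \<and> y \<le> 0" by blast
  qed (use assms in \<open>auto intro!: continuous_intros\<close>)
  then show ?thesis
    using assms(3) by (simp add: mult_le_0_iff)
qed

subsection \<open>Pointwise energy estimates\<close>

text \<open>At order 2 the Maclaurin polynomial of \<open>sin\<close> is \<open>x\<close> itself,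
  with remainder at most \<open>x\<^sup>2 / 2\<close>.\<close>

lemma abs_diff_sin_le: "\<bar>x - sin x\<bar> \<le> x\<^sup>2 / 2" for x :: real
  using Maclaurin_sin_bound[of x 2]
  by (simp add: sin_coeff_def numeral_2_eq_2 abs_minus_commute)

text \<open>For a closed curve the first term on the right integrates to zero. Hence the multiplier, although
  it enters to first order in \<open>u\<close>, contributes only quadratically to the energy estimate.\<close>

lemma multiplier_term_bound:
  fixes p p' a l1 l2 :: real
  defines "u \<equiv> p + p' - 2 * a"
  shows "2 * u * (l1 * (sin p + sin p') - l2 * (cos p + cos p'))
    \<le> 4 * (l1 * sin a - l2 * cos a) * (sin (p - a) + sin (p' - a)) + 3 * (\<bar>l1\<bar> + \<bar>l2\<bar>) * u\<^sup>2"
proof -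
  \<comment> \<open>The mean of \<open>p\<close> and \<open>p'\<close> is \<open>a + h\<close>, so
    the sum-to-product formulas extract the factor \<open>cos d\<close> from every sum below.
    \<open>k\<close> is the multiplier component at the angle \<open>a\<close>, and
    \<open>k + e\<close> the one at \<open>a + h\<close>.\<close>
  define h d where "h = u / 2" and "d = (p - p') / 2"
  define k where "k = l1 * sin a - l2 * cos a"
  define e where "e = l1 * (sin (a + h) - sin a) - l2 * (cos (a + h) - cos a)"
  have ss: "sin p + sin p' = 2 * sin (a + h) * cos d"
    "cos p + cos p' = 2 * cos (a + h) * cos d"
    "sin (p - a) + sin (p' - a) = 2 * sin h * cos d"
    unfolding sin_plus_sin cos_plus_cos by (simp_all add: h_def d_def u_def field_simps)
  have k: "\<bar>k\<bar> \<le> \<bar>l1\<bar> + \<bar>l2\<bar>"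
  proof -
    have "\<bar>l1 * sin a\<bar> \<le> \<bar>l1\<bar>" "\<bar>l2 * cos a\<bar> \<le> \<bar>l2\<bar>"
      by (simp_all add: abs_mult mult_left_le)
    then show ?thesis unfolding k_def by linarith
  qed
  have e: "\<bar>e\<bar> \<le> (\<bar>l1\<bar> + \<bar>l2\<bar>) * \<bar>h\<bar>"
  proof -
    have *: "\<bar>2 * sin (h / 2) * c\<bar> \<le> \<bar>h\<bar>" if "\<bar>c\<bar> \<le> 1" for c
    proof -
      have "\<bar>2 * sin (h / 2) * c\<bar> \<le> (2 * \<bar>h / 2\<bar>) * 1"
        unfolding abs_mult using that abs_sin_x_le_abs_x[of "h / 2"]
        by (intro mult_mono) auto
      then show ?thesis by simp
    qed
    have "sin (a + h) - sin a = 2 * sin (h / 2) * cos (a + h / 2)"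
      unfolding sin_diff_sin by (simp add: field_simps)
    moreover have "cos (a + h) - cos a = 2 * sin (h / 2) * - sin (a + h / 2)"
    proof -
      have "(a + h + a) / 2 = a + h / 2" "(a - (a + h)) / 2 = - (h / 2)"
        by (simp_all add: field_simps)
      then show ?thesis
        unfolding cos_diff_cos by (simp only: sin_minus mult_ac minus_mult_right[symmetric])
    qed
    ultimately have "\<bar>sin (a + h) - sin a\<bar> \<le> \<bar>h\<bar>" "\<bar>cos (a + h) - cos a\<bar> \<le> \<bar>h\<bar>"
      using * by (metis abs_cos_le_one, metis abs_minus_cancel abs_sin_le_one)
    then have "\<bar>l1 * (sin (a + h) - sin a)\<bar> \<le> \<bar>l1\<bar> * \<bar>h\<bar>"
      "\<bar>l2 * (cos (a + h) - cos a)\<bar> \<le> \<bar>l2\<bar> * \<bar>h\<bar>"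
      by (simp_all add: abs_mult mult_left_mono)
    then show ?thesis unfolding e_def distrib_right by linarith
  qed
  have "2 * u * (l1 * (sin p + sin p') - l2 * (cos p + cos p')) - 4 * k * (sin (p - a) + sin (p' - a))
      = 8 * cos d * (h * e + k * (h - sin h))"
    unfolding ss k_def e_def by (simp add: h_def algebra_simps)
  also have "\<dots> \<le> \<bar>8 * cos d\<bar> * \<bar>h * e + k * (h - sin h)\<bar>"
    by (metis abs_ge_self abs_mult)
  also have "\<dots> \<le> 8 * \<bar>h * e + k * (h - sin h)\<bar>"
    by (intro mult_right_mono) (auto simp: abs_mult)
  also have "\<bar>h * e + k * (h - sin h)\<bar> \<le> \<bar>h\<bar> * \<bar>e\<bar> + \<bar>k\<bar> * \<bar>h - sin h\<bar>"
    by (metis abs_mult abs_triangle_ineq)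
  also have "\<dots> \<le> \<bar>h\<bar> * ((\<bar>l1\<bar> + \<bar>l2\<bar>) * \<bar>h\<bar>) + (\<bar>l1\<bar> + \<bar>l2\<bar>) * (h\<^sup>2 / 2)"
    using e k abs_diff_sin_le[of h] by (intro add_mono mult_mono) auto
  \<comment> \<open>The two summands add up to 3/2 times \<open>h\<^sup>2\<close>, and
    \<open>h = u / 2\<close>; the factor 8 in front then produces the constant 3.\<close>
  also have "\<dots> = 3 / 8 * (\<bar>l1\<bar> + \<bar>l2\<bar>) * u\<^sup>2"
    by (simp add: h_def power2_eq_square field_simps)
  finally show ?thesis unfolding k_def by simp
qed

text \<open>\<open>B\<close> and \<open>D\<close> stand for \<beta> and its derivative at the
  density, \<open>x\<close> for the s-derivative of \<theta> minus \<open>c0\<close>, and primes for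
  the reflected point. The coercive term in \<open>x - x'\<close> absorbs the products that are
  linear in this difference, so that only \<open>v\<^sup>2\<close> remains.\<close>

lemma dissipation_term_bound:
  fixes B B' D D' x x' v b K M :: real
  assumes "b > 0" "B \<ge> b" "\<bar>B - B'\<bar> \<le> K * \<bar>v\<bar>" "\<bar>D - D'\<bar> \<le> K * \<bar>v\<bar>" "\<bar>D'\<bar> \<le> K"
    and x: "\<bar>x\<bar> \<le> M" "\<bar>x'\<bar> \<le> M"
  shows "- 2 * (x - x') * (B * x - B' * x') - v * (D * x\<^sup>2 - D' * x'\<^sup>2)
    \<le> (2 * K\<^sup>2 * M\<^sup>2 / b + K * M\<^sup>2) * v\<^sup>2"
proof -
  define w where "w = x - x'"
  have K: "K \<ge> 0" and M: "M \<ge> 0" using assms by linarith+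
  have 1: "b * w\<^sup>2 \<le> B * w\<^sup>2"
    using assms by (simp add: mult_right_mono)
  have "\<bar>w * (B - B') * x'\<bar> \<le> \<bar>w\<bar> * (K * \<bar>v\<bar>) * M"
    unfolding abs_mult using assms K by (intro mult_mono) auto
  moreover have "\<bar>v * (D - D') * x\<^sup>2\<bar> \<le> \<bar>v\<bar> * (K * \<bar>v\<bar>) * M\<^sup>2"
    unfolding abs_mult using assms K M by (intro mult_mono) (auto simp: abs_le_square_iff[symmetric])
  moreover have "\<bar>v * D' * (x + x') * w\<bar> \<le> \<bar>v\<bar> * K * (2 * M) * \<bar>w\<bar>"
    unfolding abs_mult using assms K M by (intro mult_mono) auto
  \<comment> \<open>Telescoping: \<open>B * x - B' * x' = B * w + (B - B') * x'\<close>, and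
    likewise for the quadratic terms.\<close>
  moreover have "- 2 * (x - x') * (B * x - B' * x') - v * (D * x\<^sup>2 - D' * x'\<^sup>2)
      = - 2 * (B * w\<^sup>2) - 2 * (w * (B - B') * x') - v * (D - D') * x\<^sup>2 - v * D' * (x + x') * w"
    unfolding w_def by (simp add: power2_eq_square algebra_simps)
  ultimately have "- 2 * (x - x') * (B * x - B' * x') - v * (D * x\<^sup>2 - D' * x'\<^sup>2)
      \<le> - 2 * (b * w\<^sup>2) + 4 * (K * M * \<bar>v\<bar> * \<bar>w\<bar>) + K * M\<^sup>2 * v\<^sup>2"
    using 1 by (simp add: algebra_simps power2_eq_square abs_le_iff)
  \<comment> \<open>Completing the square in \<open>\<bar>w\<bar>\<close>; the two mixed products
    contribute 2 each to the factor 4.\<close>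
  also have "- 2 * (b * w\<^sup>2) + 4 * (K * M * \<bar>v\<bar> * \<bar>w\<bar>)
      = 2 * K\<^sup>2 * M\<^sup>2 / b * v\<^sup>2 - 2 * b * (\<bar>w\<bar> - K * M * \<bar>v\<bar> / b)\<^sup>2"
    using \<open>b > 0\<close> by (simp add: power2_eq_square field_simps)
  finally show ?thesis
    using \<open>b > 0\<close> by (simp add: algebra_simps) (smt (verit) mult_nonneg_nonneg zero_le_power2)
qed

subsection \<open>The multiplier system\<close>

lemma matrix_inv_right:
  fixes A :: "real^'n^'n"
  assumes "det A \<noteq> 0"
  shows "A ** matrix_inv A = mat 1"
  using assms unfolding invertible_det_nz[symmetric] invertible_def matrix_inv_def
  by (metis (mono_tags, lifting) someI_ex)

text \<open>Multiplying by \<open>Pi_matrix\<close> removes the inverse. Later arguments use the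
  multipliers only through these two linear equations.\<close>

lemma lambda_theta_solves:
  fixes L c0 :: real and \<beta> \<theta> \<rho> :: "real \<Rightarrow> real"
  defines "A \<equiv> integral {0..L} (\<lambda>s. (sin (\<theta> s))\<^sup>2)"
    and "D \<equiv> integral {0..L} (\<lambda>s. cos (\<theta> s) * sin (\<theta> s))"
    and "C \<equiv> integral {0..L} (\<lambda>s. (cos (\<theta> s))\<^sup>2)"
    and "l \<equiv> lambda_theta L c0 \<beta> \<theta> \<rho>"
  assumes "A * C - D\<^sup>2 \<noteq> 0"
  shows "A * l $ 1 - D * l $ 2 = integral {0..L} (\<lambda>s. cos (\<theta> s) * arc_deriv L \<theta> s * \<beta> (\<rho> s) * (arc_deriv L \<theta> s - c0))"
      (is "_ = ?b1")
    and "C * l $ 2 - D * l $ 1 = integral {0..L} (\<lambda>s. sin (\<theta> s) * arc_deriv L \<theta> s * \<beta> (\<rho> s) * (arc_deriv L \<theta> s - c0))"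
      (is "_ = ?b2")
proof -
  let ?P = "Pi_matrix L \<theta>"
  have P: "?P $ 1 $ 1 = A" "?P $ 1 $ 2 = - D" "?P $ 2 $ 1 = - D" "?P $ 2 $ 2 = C"
    by (simp_all add: Pi_matrix_def A_def C_def D_def)
  have "det ?P \<noteq> 0"
    using assms(5) by (simp add: det_2 P power2_eq_square)
  then have "?P *v l = vector [?b1, ?b2]"
    unfolding l_def lambda_theta_def matrix_vector_mul_assoc by (simp add: matrix_inv_right)
  then have "(?P *v l) $ 1 = ?b1" "(?P *v l) $ 2 = ?b2" by simp_all
  then show "A * l $ 1 - D * l $ 2 = ?b1" "C * l $ 2 - D * l $ 1 = ?b2"
    by (simp_all add: matrix_vector_mult_def sum_2 P)
qed

text \<open>The values from \<open>\<theta> 0\<close> to \<open>\<theta> L\<close> fill a full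
  period, so the intermediate value theorem reaches the representative \<open>y\<close> of
  \<open>x\<close> modulo 2 pi.\<close>

lemma full_turn_attains:
  fixes \<theta> :: "real \<Rightarrow> real"
  assumes "L > 0" "continuous_on {0..L} \<theta>" "\<theta> L - \<theta> 0 = 2 * pi"
  obtains s where "s \<in> {0..L}" "sin (\<theta> s) = sin x" "cos (\<theta> s) = cos x"
proof -
  define k where "k = \<lfloor>(x - \<theta> 0) / (2 * pi)\<rfloor>"
  define y where "y = x - 2 * pi * of_int k"
  have "of_int k \<le> (x - \<theta> 0) / (2 * pi)" "(x - \<theta> 0) / (2 * pi) < of_int k + 1"
    unfolding k_def by linarith+
  then have "\<theta> 0 \<le> y" "y \<le> \<theta> L"
    using assms(3) unfolding y_def by (simp_all add: field_simps)
  then obtain s where s: "s \<in> {0..L}" "\<theta> s = y"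
    using IVT'[of \<theta> 0 y L] assms(1,2) by auto
  have "x = y + 2 * pi * of_int k" by (simp add: y_def)
  then have "sin (\<theta> s) = sin x" "cos (\<theta> s) = cos x"
    using s sin.plus_of_int[of y k] cos.plus_of_int[of y k] by (simp_all add: mult.commute)
  with s show ?thesis using that by blast
qed

text \<open>This is the strict Cauchy-Schwarz inequality: equality would make sine and cosine of
  \<theta> linearly dependent, although the tangent passes through all directions.\<close>

lemma Pi_det_positive:
  fixes \<theta> :: "real \<Rightarrow> real"
  assumes "L > 0" and cont: "continuous_on {0..L} \<theta>" and turn: "\<theta> L - \<theta> 0 = 2 * pi"
  shows "integral {0..L} (\<lambda>s. (sin (\<theta> s))\<^sup>2) * integral {0..L} (\<lambda>s. (cos (\<theta> s))\<^sup>2)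
    - (integral {0..L} (\<lambda>s. cos (\<theta> s) * sin (\<theta> s)))\<^sup>2 > 0"
    (is "?A * ?C - ?D\<^sup>2 > 0")
proof (rule ccontr)
  assume neg: "\<not> ?A * ?C - ?D\<^sup>2 > 0"
  note ci = continuous_intros cont
  \<comment> \<open>The coefficients are chosen so that the integral of \<open>?f\<close> is
    \<open>?C\<close> times the determinant.\<close>
  let ?f = "\<lambda>s. (?C * sin (\<theta> s) - ?D * cos (\<theta> s))\<^sup>2"
  have C0: "?C \<ge> 0"
    by (intro integral_nonneg integrable_continuous_real ci) auto
  have int: "(\<lambda>s. (sin (\<theta> s))\<^sup>2) integrable_on {0..L}" "(\<lambda>s. (cos (\<theta> s))\<^sup>2) integrable_on {0..L}"
    "(\<lambda>s. cos (\<theta> s) * sin (\<theta> s)) integrable_on {0..L}"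
    by (intro integrable_continuous_real ci)+
  have "integral {0..L} ?f = integral {0..L} (\<lambda>s. ?C\<^sup>2 * (sin (\<theta> s))\<^sup>2
      - 2 * ?C * ?D * (cos (\<theta> s) * sin (\<theta> s)) + ?D\<^sup>2 * (cos (\<theta> s))\<^sup>2)"
    by (rule integral_cong) (simp add: power2_eq_square algebra_simps)
  also have "\<dots> = ?C\<^sup>2 * ?A - 2 * ?C * ?D * ?D + ?D\<^sup>2 * ?C"
    by (intro integral_unique has_integral_add has_integral_diff has_integral_mult_right
        integrable_integral int)
  also have "\<dots> = ?C * (?A * ?C - ?D\<^sup>2)"
    by (simp add: power2_eq_square algebra_simps)
  also have "\<dots> \<le> 0"
    using neg C0 by (simp add: mult_nonneg_nonpos)
  moreover have "integral {0..L} ?f \<ge> 0"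
    by (intro integral_nonneg integrable_continuous_real ci) auto
  ultimately have "integral {0..L} ?f = 0" by linarith
  then have f0: "?f s = 0" if "s \<in> {0..L}" for s
    using integral_eq_0_iff[of 0 L ?f] that \<open>L > 0\<close> by (simp add: continuous_intros cont)
  \<comment> \<open>The direction pi / 2 forces \<open>?C = 0\<close>, so the cosine vanishes
    identically; the direction 0 contradicts this.\<close>
  obtain s where "s \<in> {0..L}" "sin (\<theta> s) = sin (pi / 2)" "cos (\<theta> s) = cos (pi / 2)"
    by (rule full_turn_attains[OF assms])
  with f0[of s] have "?C = 0" by simp
  then have "(cos (\<theta> s))\<^sup>2 = 0" if "s \<in> {0..L}" for s
    using integral_eq_0_iff[of 0 L "\<lambda>s. (cos (\<theta> s))\<^sup>2"] that \<open>L > 0\<close>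
    by (simp add: continuous_intros cont)
  moreover obtain s where "s \<in> {0..L}" "sin (\<theta> s) = sin 0" "cos (\<theta> s) = cos 0"
    by (rule full_turn_attains[OF assms])
  ultimately show False by force
qed

subsection \<open>Regularity classes\<close>

lemma smooth_real_deriv:
  assumes "smooth_real f"
  shows "(f has_real_derivative deriv f x) (at x)"
    "(deriv f has_real_derivative deriv (deriv f) x) (at x)"
    "continuous_on UNIV f" "continuous_on UNIV (deriv f)" "continuous_on UNIV (deriv (deriv f))"
proof -
  have d: "(deriv ^^ n) f differentiable_on UNIV" for n
    using assms by (simp add: smooth_real_def)
  have *: "f differentiable_on UNIV" "deriv f differentiable_on UNIV" "deriv (deriv f) differentiable_on UNIV"
    using d[of 0] d[of 1] d[of 2] by (simp_all add: numeral_2_eq_2)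
  then show "continuous_on UNIV f" "continuous_on UNIV (deriv f)" "continuous_on UNIV (deriv (deriv f))"
    by (simp_all add: differentiable_imp_continuous_on)
  show "(f has_real_derivative deriv f x) (at x)"
    "(deriv f has_real_derivative deriv (deriv f) x) (at x)"
    using * by (simp_all add: differentiable_on_def DERIV_deriv_iff_real_differentiable)
qed

lemma smooth_cylinder_slice:
  assumes "smooth_cylinder L f" "t > 0"
  shows "smooth_interval L (f t)"
proof -
  have "(partial_s L ^^ n) f \<in> partials L f" for n
    by (induction n) (auto intro: partials.intros)
  moreover have "partial_s L g t = arc_deriv L (g t)" for g
    by (simp add: partial_s_def fun_eq_iff)
  then have "(arc_deriv L ^^ n) (f t) = (partial_s L ^^ n) f t" for n
    by (induction n) auto
  ultimately show ?thesis
    using assms unfolding smooth_interval_def smooth_cylinder_def differentiable_on_def by simp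
qed

lemma smooth_cylinder_partial:
  assumes "smooth_cylinder L f" "g \<in> partials L f"
  shows "continuous_on ({0<..} \<times> {0..L}) (\<lambda>(t, s). g t s)"
    "\<lbrakk>t > 0; s \<in> {0..L}\<rbrakk> \<Longrightarrow> ((\<lambda>r. g r s) has_real_derivative partial_t g t s) (at t)"
    "\<lbrakk>t > 0; s \<in> {0..L}\<rbrakk> \<Longrightarrow> (g t has_real_derivative arc_deriv L (g t) s) (at s within {0..L})"
  using assms unfolding smooth_cylinder_def partial_t_def
  by (auto intro: arc_deriv_has_derivative simp: DERIV_deriv_iff_real_differentiable)

text \<open>\<open>smooth_cylinder\<close> says nothing about time 0. Continuity up to the initial
  time, and with it boundedness on compact time intervals, comes from here.\<close>

lemma continuous_into_C2_cylinder:
  assumes "continuous_into_C2 L f"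
  shows "continuous_on ({0..} \<times> {0..L}) (\<lambda>(t, s). f t s)"
    "continuous_on ({0..} \<times> {0..L}) (\<lambda>(t, s). arc_deriv L (f t) s)"
proof -
  have lim: "uniform_limit {0..L} (\<lambda>r. (arc_deriv L ^^ j) (f r)) ((arc_deriv L ^^ j) (f t)) (at t within {0..})"
    if "j \<le> 2" "t \<ge> 0" for j t
    using assms that by (simp add: continuous_into_C2_def)
  show "continuous_on ({0..} \<times> {0..L}) (\<lambda>(t, s). f t s)"
    using assms lim[of 0] unfolding continuous_into_C2_def C2_interval_def
    by (intro continuous_on_uniform_limit_cylinder) (auto intro: differentiable_imp_continuous_on)
  show "continuous_on ({0..} \<times> {0..L}) (\<lambda>(t, s). arc_deriv L (f t) s)"
    using assms lim[of 1] unfolding continuous_into_C2_def C2_interval_def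
    by (intro continuous_on_uniform_limit_cylinder) (auto intro: differentiable_imp_continuous_on)
qed

lemma continuous_on_cylinder_compose:
  assumes "continuous_on (T \<times> S) (\<lambda>(t, s). g t s)"
    and "continuous_on X f" "continuous_on X h" "\<And>x. x \<in> X \<Longrightarrow> f x \<in> T" "\<And>x. x \<in> X \<Longrightarrow> h x \<in> S"
  shows "continuous_on X (\<lambda>x. g (f x) (h x))"
  using continuous_on_compose2[OF assms(1) continuous_on_Pair[OF assms(2,3)]] assms(4,5) by auto

lemma continuous_on_compact_bound:
  fixes f :: "'a::topological_space \<Rightarrow> real"
  assumes "compact S" "continuous_on S f"
  obtains M where "\<And>x. x \<in> S \<Longrightarrow> \<bar>f x\<bar> \<le> M"
  using compact_imp_bounded[OF compact_continuous_image[OF assms(2,1)]]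
  unfolding bounded_iff by auto

lemma deriv_bound_imp_abs_diff_le:
  fixes f :: "real \<Rightarrow> real"
  assumes "\<And>x. (f has_real_derivative f' x) (at x)" "\<And>x. \<bar>x\<bar> \<le> M \<Longrightarrow> \<bar>f' x\<bar> \<le> K" "\<bar>x\<bar> \<le> M" "\<bar>y\<bar> \<le> M"
  shows "\<bar>f x - f y\<bar> \<le> K * \<bar>x - y\<bar>"
  using field_differentiable_bound[of "{-M..M}" f f' K x y] assms
  by (auto simp: abs_le_iff intro: has_field_derivative_at_within)

subsection \<open>Conservation of closedness\<close>

text \<open>The initial data are the slices at time 0. The turn at time 0 is a separate assumption,
  since \<open>flow_solution\<close> states boundary conditions for positive times only.\<close>

locale symmetric_flow =
  fixes L \<mu> c0 a :: real and \<beta> :: "real \<Rightarrow> real" and \<theta> \<rho> :: "real \<Rightarrow> real \<Rightarrow> real"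
  assumes L_pos: "L > 0" and mu_pos: "\<mu> > 0"
    and beta_smooth: "smooth_real \<beta>" and beta_pos: "\<And>x. \<beta> x > 0"
    and flow: "flow_solution L \<mu> 1 c0 \<beta> (\<theta> 0) (\<rho> 0) \<theta> \<rho>"
    and initial_turn: "\<theta> 0 L - \<theta> 0 0 = 2 * pi"
    and initial_closed: "integral {0..L} (\<lambda>s. sin (\<theta> 0 s)) = 0" "integral {0..L} (\<lambda>s. cos (\<theta> 0 s)) = 0"
    and initial_symmetric: "\<And>s. s \<in> {0..L} \<Longrightarrow> \<theta> 0 s + \<theta> 0 (L - s) = 2 * a"
      "\<And>s. s \<in> {0..L} \<Longrightarrow> \<rho> 0 s = \<rho> 0 (L - s)"
begin

abbreviation "\<theta>s t \<equiv> arc_deriv L (\<theta> t)"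
abbreviation "\<rho>s t \<equiv> arc_deriv L (\<rho> t)"
abbreviation "multiplier t \<equiv> lambda_theta L c0 \<beta> (\<theta> t) (\<rho> t)"

definition flux :: "real \<Rightarrow> real \<Rightarrow> real" where
  "flux t s = \<beta> (\<rho> t s) * (\<theta>s t s - c0)"

lemma cylinder: "smooth_cylinder L \<theta>" "smooth_cylinder L \<rho>"
  and C2: "continuous_into_C2 L \<theta>" "continuous_into_C2 L \<rho>"
  using flow by (auto simp: flow_solution_def)

lemma turn: "t \<ge> 0 \<Longrightarrow> \<theta> t L - \<theta> t 0 = 2 * pi"
  using flow initial_turn by (cases "t = 0") (auto simp: flow_solution_def)

lemma periodic:
  assumes "t > 0"
  shows "\<rho> t L = \<rho> t 0" "\<theta>s t L = \<theta>s t 0" "flux t L = flux t 0"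
  using flow assms by (auto simp: flow_solution_def flux_def)

lemma evolution:
  assumes "t > 0" "s \<in> {0..L}"
  shows "partial_t \<theta> t s = arc_deriv L (flux t) s + multiplier t $ 1 * sin (\<theta> t s)
      - multiplier t $ 2 * cos (\<theta> t s)"
    "partial_t \<rho> t s = \<mu> * arc_deriv L (\<rho>s t) s
      - (1 / 2) * deriv \<beta> (\<rho> t s) * (\<theta>s t s - c0)\<^sup>2 - lambda_rho L c0 \<beta> (\<theta> t) (\<rho> t)"
  using flow assms by (auto simp: flow_solution_def flux_def[abs_def] numeral_2_eq_2)

lemma cylinder_derivs:
  assumes f: "smooth_cylinder L f" and "t > 0" "s \<in> {0..L}"
  shows "((\<lambda>r. f r s) has_real_derivative partial_t f t s) (at t)"
    "(f t has_real_derivative arc_deriv L (f t) s) (at s within {0..L})"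
    "(arc_deriv L (f t) has_real_derivative arc_deriv L (arc_deriv L (f t)) s) (at s within {0..L})"
proof -
  have "partial_s L f t = arc_deriv L (f t)"
    by (simp add: partial_s_def fun_eq_iff)
  with smooth_cylinder_partial(3)[OF f partials.space[OF partials.base], of t s] assms(2,3)
  show "(arc_deriv L (f t) has_real_derivative arc_deriv L (arc_deriv L (f t)) s) (at s within {0..L})"
    by simp
qed (use smooth_cylinder_partial(2,3)[OF f partials.base] assms in auto)

lemmas theta_derivs = cylinder_derivs[OF cylinder(1)]
  and rho_derivs = cylinder_derivs[OF cylinder(2)]

lemma flux_deriv:
  assumes "t > 0" "s \<in> {0..L}"
  shows "(flux t has_real_derivative arc_deriv L (flux t) s) (at s within {0..L})"
proof (rule arc_deriv_has_derivative)
  have "((\<lambda>s. \<beta> (\<rho> t s)) has_real_derivative deriv \<beta> (\<rho> t s) * \<rho>s t s) (at s within {0..L})"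
    using DERIV_chain2[OF smooth_real_deriv(1)[OF beta_smooth] rho_derivs(2)[OF assms]] by simp
  from DERIV_mult[OF this DERIV_diff[OF theta_derivs(3)[OF assms] DERIV_const[of c0]]]
  show "flux t differentiable (at s within {0..L})"
    unfolding flux_def[abs_def] has_field_derivative_def by (rule differentiableI)
qed

context
  fixes X :: "'x::topological_space set" and f h :: "'x \<Rightarrow> real"
  assumes f: "continuous_on X f" and h: "continuous_on X h" "\<And>x. x \<in> X \<Longrightarrow> h x \<in> {0..L}"
begin

text \<open>Composition with arbitrary \<open>f\<close> and \<open>h\<close> lets one statement
  serve fixed times, the whole cylinder and the reflected point \<open>L - s\<close>.\<close>

lemma continuous_on_state:
  assumes "\<And>x. x \<in> X \<Longrightarrow> f x \<ge> 0"
  shows "continuous_on X (\<lambda>x. \<theta> (f x) (h x))" "continuous_on X (\<lambda>x. \<rho> (f x) (h x))"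
    "continuous_on X (\<lambda>x. \<theta>s (f x) (h x))" "continuous_on X (\<lambda>x. flux (f x) (h x))"
proof -
  show 1: "continuous_on X (\<lambda>x. \<theta> (f x) (h x))" "continuous_on X (\<lambda>x. \<rho> (f x) (h x))"
    "continuous_on X (\<lambda>x. \<theta>s (f x) (h x))"
    using assms
    by (intro continuous_on_cylinder_compose[OF continuous_into_C2_cylinder(1)[OF C2(1)] f h(1)]
        continuous_on_cylinder_compose[OF continuous_into_C2_cylinder(1)[OF C2(2)] f h(1)]
        continuous_on_cylinder_compose[OF continuous_into_C2_cylinder(2)[OF C2(1)] f h(1)]; use h(2) in auto)+
  show "continuous_on X (\<lambda>x. flux (f x) (h x))"
    unfolding flux_def
    by (intro continuous_intros 1 continuous_on_compose2[OF smooth_real_deriv(3)[OF beta_smooth] 1(2)]) auto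
qed

lemma continuous_on_time_derivs:
  assumes "\<And>x. x \<in> X \<Longrightarrow> f x > 0"
  shows "continuous_on X (\<lambda>x. partial_t \<theta> (f x) (h x))" "continuous_on X (\<lambda>x. partial_t \<rho> (f x) (h x))"
  using assms
  by (intro continuous_on_cylinder_compose[OF
        smooth_cylinder_partial(1)[OF cylinder(1) partials.time[OF partials.base]] f h(1)]
      continuous_on_cylinder_compose[OF
        smooth_cylinder_partial(1)[OF cylinder(2) partials.time[OF partials.base]] f h(1)]; use h(2) in auto)+

end

lemma continuous_on_state_slice:
  assumes "t \<ge> 0"
  shows "continuous_on {0..L} (\<theta> t)" "continuous_on {0..L} (\<rho> t)"
    "continuous_on {0..L} (\<theta>s t)" "continuous_on {0..L} (flux t)"
  using assms continuous_on_state[of "{0..L}" "\<lambda>_. t" "\<lambda>s. s"] by (auto intro: continuous_intros)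

section \<open>The multiplier system along the flow\<close>

definition "sin2 t = integral {0..L} (\<lambda>s. (sin (\<theta> t s))\<^sup>2)"
definition "cos2 t = integral {0..L} (\<lambda>s. (cos (\<theta> t s))\<^sup>2)"
definition "cossin t = integral {0..L} (\<lambda>s. cos (\<theta> t s) * sin (\<theta> t s))"
definition "cosflux t = integral {0..L} (\<lambda>s. cos (\<theta> t s) * \<theta>s t s * flux t s)"
definition "sinflux t = integral {0..L} (\<lambda>s. sin (\<theta> t s) * \<theta>s t s * flux t s)"

lemma det_pos: "t \<ge> 0 \<Longrightarrow> sin2 t * cos2 t - (cossin t)\<^sup>2 > 0"
  unfolding sin2_def cos2_def cossin_def
  by (intro Pi_det_positive L_pos continuous_on_state_slice turn)

lemma multiplier_system:
  assumes "t \<ge> 0"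
  shows "sin2 t * multiplier t $ 1 - cossin t * multiplier t $ 2 = cosflux t"
    "cos2 t * multiplier t $ 2 - cossin t * multiplier t $ 1 = sinflux t"
  using lambda_theta_solves[of L "\<theta> t" c0 \<beta> "\<rho> t"] det_pos[OF assms]
  by (simp_all add: sin2_def cos2_def cossin_def cosflux_def sinflux_def flux_def mult.assoc)

lemma continuous_on_integral:
  fixes g :: "real \<Rightarrow> real \<Rightarrow> real"
  assumes "continuous_on (U \<times> {0..L}) (\<lambda>x. g (fst x) (snd x))"
  shows "continuous_on U (\<lambda>t. integral {0..L} (g t))"
  using integral_continuous_on_param[of U 0 L g] assms by (simp add: case_prod_beta')

text \<open>Continuity includes time 0, which bounds the multipliers on every compact time
  interval.\<close>

lemma continuous_on_multiplier: "continuous_on {0..} (\<lambda>t. multiplier t $ i)"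
proof -
  let ?det = "\<lambda>t. sin2 t * cos2 t - (cossin t)\<^sup>2"
  have c: "continuous_on {0..} sin2" "continuous_on {0..} cos2" "continuous_on {0..} cossin"
    "continuous_on {0..} cosflux" "continuous_on {0..} sinflux"
    unfolding sin2_def[abs_def] cos2_def[abs_def] cossin_def[abs_def] cosflux_def[abs_def] sinflux_def[abs_def]
    by (intro continuous_on_integral continuous_intros continuous_on_state; auto)+
  have d: "?det t \<noteq> 0" if "t \<in> {0..}" for t
    using det_pos[of t] that by simp
  \<comment> \<open>Cramer's rule for \<open>multiplier_system\<close>.\<close>
  have e: "multiplier t $ 1 = (cos2 t * cosflux t + cossin t * sinflux t) / ?det t"
    "multiplier t $ 2 = (sin2 t * sinflux t + cossin t * cosflux t) / ?det t" if "t \<in> {0..}" for t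
    using d[OF that] multiplier_system[of t, symmetric] that
    by (simp_all add: eq_divide_eq) (simp_all add: power2_eq_square algebra_simps)
  have "continuous_on {0..} (\<lambda>t. multiplier t $ 1)"
  proof (rule continuous_on_eq)
    show "continuous_on {0..} (\<lambda>t. (cos2 t * cosflux t + cossin t * sinflux t) / ?det t)"
      using d by (intro continuous_intros c) auto
  qed (simp add: e)
  moreover have "continuous_on {0..} (\<lambda>t. multiplier t $ 2)"
  proof (rule continuous_on_eq)
    show "continuous_on {0..} (\<lambda>t. (sin2 t * sinflux t + cossin t * cosflux t) / ?det t)"
      using d by (intro continuous_intros c) auto
  qed (simp add: e)
  ultimately show ?thesis
    using exhaust_2[of i] by auto
qed

text \<open>The multipliers are exactly the ones that make this derivative vanish. The phase
  \<open>x\<close> treats both closing conditions at once; the energy estimate takes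
  \<open>x = a\<close>.\<close>

lemma integral_sin_deriv:
  assumes "t > 0"
  shows "((\<lambda>t. integral {0..L} (\<lambda>s. sin (\<theta> t s - x))) has_real_derivative 0) (at t)"
proof -
  let ?d = "\<lambda>(t::real) s. cos (\<theta> t s - x) * partial_t \<theta> t s"
  have "((\<lambda>t. integral (cbox 0 L) (\<lambda>s. sin (\<theta> t s - x))) has_real_derivative integral (cbox 0 L) (?d t))
      (at t within {0<..})"
  proof (rule leibniz_rule_field_derivative)
    fix r s :: real assume "r \<in> {0<..}" "s \<in> cbox 0 L"
    then show "((\<lambda>r. sin (\<theta> r s - x)) has_real_derivative ?d r s) (at r within {0<..})"
      by (auto intro!: derivative_eq_intros theta_derivs(1)[THEN has_field_derivative_at_within])
  next
    fix r :: real assume "r \<in> {0<..}"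
    then show "(\<lambda>s. sin (\<theta> r s - x)) integrable_on cbox 0 L"
      by (auto intro!: integrable_continuous_real continuous_intros continuous_on_state_slice)
  next
    show "continuous_on ({0<..} \<times> cbox 0 L) (\<lambda>(r, s). ?d r s)"
      unfolding case_prod_beta'
      by (intro continuous_intros continuous_on_state continuous_on_time_derivs) auto
  qed (use assms in auto)
  then have deriv: "((\<lambda>t. integral {0..L} (\<lambda>s. sin (\<theta> t s - x))) has_real_derivative integral {0..L} (?d t)) (at t)"
    using assms by (simp add: at_within_open[of t "{0<..}"])
  have cs: "continuous_on {0..L} (\<theta> t)" "continuous_on {0..L} (\<theta>s t)" "continuous_on {0..L} (flux t)"
    using continuous_on_state_slice[of t] assms by auto
  \<comment> \<open>\<open>?p\<close> is the s-derivative of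
    \<open>cos (\<theta> t s - x) * flux t s\<close>, which has equal values at both
    endpoints.\<close>
  let ?p = "\<lambda>s. cos (\<theta> t s - x) * arc_deriv L (flux t) s - sin (\<theta> t s - x) * \<theta>s t s * flux t s"
  have "(?p has_integral cos (\<theta> t L - x) * flux t L - cos (\<theta> t 0 - x) * flux t 0) {0..L}"
    using L_pos assms
    by (intro has_integral_derivative)
      (auto intro!: derivative_eq_intros theta_derivs(2) flux_deriv)
  moreover have "cos (\<theta> t L - x) = cos (\<theta> t 0 - x)"
    using turn[of t] assms cos_periodic[of "\<theta> t 0 - x"] by (simp add: algebra_simps)
  ultimately have p: "(?p has_integral 0) {0..L}"
    using periodic[OF assms] by simp
  have i: "((\<lambda>s. (sin (\<theta> t s))\<^sup>2) has_integral sin2 t) {0..L}"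
    "((\<lambda>s. (cos (\<theta> t s))\<^sup>2) has_integral cos2 t) {0..L}"
    "((\<lambda>s. cos (\<theta> t s) * sin (\<theta> t s)) has_integral cossin t) {0..L}"
    "((\<lambda>s. cos (\<theta> t s) * \<theta>s t s * flux t s) has_integral cosflux t) {0..L}"
    "((\<lambda>s. sin (\<theta> t s) * \<theta>s t s * flux t s) has_integral sinflux t) {0..L}"
    unfolding sin2_def cos2_def cossin_def cosflux_def sinflux_def
    by (intro integrable_integral integrable_continuous_real continuous_intros cs)+
  let ?l1 = "multiplier t $ 1" and ?l2 = "multiplier t $ 2"
  \<comment> \<open>\<open>?e\<close> rewrites \<open>?d t\<close> through \<open>?p\<close> and the
    integrands of the multiplier system, after expanding the phase \<open>x\<close>.\<close>
  let ?e = "\<lambda>s. ?p s + (cos x * (sin (\<theta> t s) * \<theta>s t s * flux t s) - sin x * (cos (\<theta> t s) * \<theta>s t s * flux t s)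
    + ?l1 * (cos x * (cos (\<theta> t s) * sin (\<theta> t s)) + sin x * (sin (\<theta> t s))\<^sup>2)
    - ?l2 * (cos x * (cos (\<theta> t s))\<^sup>2 + sin x * (cos (\<theta> t s) * sin (\<theta> t s))))"
  have "(?e has_integral 0 + (cos x * sinflux t - sin x * cosflux t
      + ?l1 * (cos x * cossin t + sin x * sin2 t) - ?l2 * (cos x * cos2 t + sin x * cossin t))) {0..L}"
    by (intro has_integral_add has_integral_diff has_integral_mult_right p i)
  \<comment> \<open>This is \<open>cos x\<close> times the second equation of the system minus
    \<open>sin x\<close> times the first.\<close>
  moreover have "0 + (cos x * sinflux t - sin x * cosflux t
      + ?l1 * (cos x * cossin t + sin x * sin2 t) - ?l2 * (cos x * cos2 t + sin x * cossin t)) = 0"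
    using assms by (simp add: multiplier_system[of t, symmetric] algebra_simps)
  moreover have "?e s = ?d t s" if "s \<in> {0..L}" for s
    using that assms by (simp add: evolution sin_diff cos_diff power2_eq_square algebra_simps)
  ultimately have "(?d t has_integral 0) {0..L}"
    using has_integral_eq[of "{0..L}" ?e "?d t" 0] by simp
  then have "integral {0..L} (?d t) = 0" by (rule integral_unique)
  with deriv show ?thesis by simp
qed

text \<open>The integral is constant for positive times, and its continuity at time 0 transfers the
  closedness of the initial curve.\<close>

lemma integral_sin_zero:
  assumes "t > 0"
  shows "((\<lambda>s. sin (\<theta> t s - x)) has_integral 0) {0..L}"
proof -
  let ?I = "\<lambda>t. integral {0..L} (\<lambda>s. sin (\<theta> t s - x))"
  have "continuous_on {0..t} ?I"
    by (intro continuous_on_integral continuous_intros continuous_on_state) auto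
  then have "?I t = ?I 0"
    using assms integral_sin_deriv by (intro DERIV_isconst_end) auto
  also have "\<dots> = integral {0..L} (\<lambda>s. cos x * sin (\<theta> 0 s) - sin x * cos (\<theta> 0 s))"
    by (simp add: sin_diff mult.commute)
  also have "\<dots> = cos x * integral {0..L} (\<lambda>s. sin (\<theta> 0 s)) - sin x * integral {0..L} (\<lambda>s. cos (\<theta> 0 s))"
    by (intro integral_unique has_integral_diff has_integral_mult_right integrable_integral
        integrable_continuous_real continuous_intros continuous_on_state_slice) auto
  finally have "?I t = 0" by (simp add: initial_closed)
  moreover have "(\<lambda>s. sin (\<theta> t s - x)) integrable_on {0..L}"
    using assms by (intro integrable_continuous_real continuous_intros continuous_on_state_slice) auto
  ultimately show ?thesis
    by (metis integrable_integral)
qed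

subsection \<open>Energy estimate for the reflection defect\<close>

text \<open>The reflected pair is \<open>2 * a - \<theta> t (L - s)\<close> and
  \<open>\<rho> t (L - s)\<close>; \<open>u\<close> and \<open>v\<close> are the differences from
  it.\<close>

definition "u t s = \<theta> t s + \<theta> t (L - s) - 2 * a"
definition "v t s = \<rho> t s - \<rho> t (L - s)"
definition "energy t = integral {0..L} (\<lambda>s. (u t s)\<^sup>2 + (v t s)\<^sup>2)"
definition "energy_rate t s = 2 * u t s * (partial_t \<theta> t s + partial_t \<theta> t (L - s))
  + 2 * v t s * (partial_t \<rho> t s - partial_t \<rho> t (L - s))"

lemma continuous_on_u_v: "t \<ge> 0 \<Longrightarrow> continuous_on {0..L} (u t)" "t \<ge> 0 \<Longrightarrow> continuous_on {0..L} (v t)"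
  unfolding u_def[abs_def] v_def[abs_def]
  by (intro continuous_intros continuous_on_state; simp)+

lemma continuous_on_energy: "continuous_on {0..} energy"
  unfolding energy_def[abs_def] u_def v_def
  by (intro continuous_on_integral continuous_intros continuous_on_state) auto

lemma continuous_on_energy_rate: "continuous_on ({0<..} \<times> {0..L}) (\<lambda>x. energy_rate (fst x) (snd x))"
  unfolding energy_rate_def u_def v_def
  by (intro continuous_intros continuous_on_state continuous_on_time_derivs) auto

lemma energy_deriv:
  assumes "t > 0"
  shows "(energy has_real_derivative integral {0..L} (energy_rate t)) (at t)"
    and "(energy_rate t has_integral integral {0..L} (energy_rate t)) {0..L}"
proof -
  have "((\<lambda>t. integral (cbox 0 L) (\<lambda>s. (u t s)\<^sup>2 + (v t s)\<^sup>2)) has_real_derivative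
      integral (cbox 0 L) (energy_rate t)) (at t within {0<..})"
  proof (rule leibniz_rule_field_derivative)
    fix r s :: real assume "r \<in> {0<..}" "s \<in> cbox 0 L"
    then have rs: "r > 0" "s \<in> {0..L}" "L - s \<in> {0..L}" by auto
    show "((\<lambda>r. (u r s)\<^sup>2 + (v r s)\<^sup>2) has_real_derivative energy_rate r s) (at r within {0<..})"
      unfolding u_def v_def
      by (rule derivative_eq_intros has_field_derivative_at_within[OF theta_derivs(1)[OF rs(1,2)]]
          has_field_derivative_at_within[OF theta_derivs(1)[OF rs(1,3)]]
          has_field_derivative_at_within[OF rho_derivs(1)[OF rs(1,2)]]
          has_field_derivative_at_within[OF rho_derivs(1)[OF rs(1,3)]] refl)+
        (simp add: energy_rate_def u_def v_def algebra_simps)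
  next
    fix r :: real assume "r \<in> {0<..}"
    then show "(\<lambda>s. (u r s)\<^sup>2 + (v r s)\<^sup>2) integrable_on cbox 0 L"
      by (auto intro!: integrable_continuous_real continuous_intros continuous_on_u_v)
  qed (use assms continuous_on_energy_rate in \<open>auto simp: case_prod_beta'\<close>)
  then show "(energy has_real_derivative integral {0..L} (energy_rate t)) (at t)"
    using assms by (simp add: at_within_open[of t "{0<..}"] energy_def[abs_def])
  have "continuous_on {0..L} (energy_rate t)"
    unfolding energy_rate_def[abs_def] u_def v_def using assms
    by (intro continuous_intros continuous_on_state continuous_on_time_derivs) auto
  then show "(energy_rate t has_integral integral {0..L} (energy_rate t)) {0..L}"
    by (intro integrable_integral integrable_continuous_real)
qed

text \<open>The first two subtracted terms below are the \<open>s\<close>-derivatives of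
  \<open>2 u (flux(s) - flux(L - s))\<close> and \<open>2 \<mu> v v\<^sub>s\<close>, which vanish at both endpoints, so no integration by parts
  with integrability side conditions is needed.\<close>

lemma energy_rate_bound:
  assumes "t > 0" "s \<in> {0..L}" "b > 0"
    and x: "\<And>s. s \<in> {0..L} \<Longrightarrow> \<bar>\<theta>s t s - c0\<bar> \<le> M" and N: "\<And>s. s \<in> {0..L} \<Longrightarrow> \<bar>\<rho> t s\<bar> \<le> N"
    and b: "\<And>y. \<bar>y\<bar> \<le> N \<Longrightarrow> b \<le> \<beta> y"
    and K: "\<And>y. \<bar>y\<bar> \<le> N \<Longrightarrow> \<bar>deriv \<beta> y\<bar> \<le> K" "\<And>y. \<bar>y\<bar> \<le> N \<Longrightarrow> \<bar>deriv (deriv \<beta>) y\<bar> \<le> K"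
    and l: "\<bar>multiplier t $ 1\<bar> + \<bar>multiplier t $ 2\<bar> \<le> \<Lambda>"
  shows "energy_rate t s
      - 2 * ((\<theta>s t s - \<theta>s t (L - s)) * (flux t s - flux t (L - s))
         + u t s * (arc_deriv L (flux t) s + arc_deriv L (flux t) (L - s)))
      - 2 * \<mu> * ((\<rho>s t s + \<rho>s t (L - s))\<^sup>2
         + v t s * (arc_deriv L (\<rho>s t) s - arc_deriv L (\<rho>s t) (L - s)))
      - 4 * (multiplier t $ 1 * sin a - multiplier t $ 2 * cos a)
         * (sin (\<theta> t s - a) + sin (\<theta> t (L - s) - a))
    \<le> (2 * K\<^sup>2 * M\<^sup>2 / b + K * M\<^sup>2 + 3 * \<Lambda>) * ((u t s)\<^sup>2 + (v t s)\<^sup>2)" (is "?lhs \<le> _")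
proof -
  let ?r = "L - s" and ?l1 = "multiplier t $ 1" and ?l2 = "multiplier t $ 2"
  have r: "?r \<in> {0..L}" using assms(2) by auto
  \<comment> \<open>\<open>mult\<close> collects the multiplier terms, less the part whose integral
    vanishes by closedness; \<open>diss\<close> collects the terms with \<beta>.\<close>
  define mult where "mult = 2 * u t s * (?l1 * (sin (\<theta> t s) + sin (\<theta> t ?r)) - ?l2 * (cos (\<theta> t s) + cos (\<theta> t ?r)))
      - 4 * (?l1 * sin a - ?l2 * cos a) * (sin (\<theta> t s - a) + sin (\<theta> t ?r - a))"
  define diss where "diss = - 2 * ((\<theta>s t s - c0) - (\<theta>s t ?r - c0)) * (\<beta> (\<rho> t s) * (\<theta>s t s - c0) - \<beta> (\<rho> t ?r) * (\<theta>s t ?r - c0))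
      - v t s * (deriv \<beta> (\<rho> t s) * (\<theta>s t s - c0)\<^sup>2 - deriv \<beta> (\<rho> t ?r) * (\<theta>s t ?r - c0)\<^sup>2)"
  \<comment> \<open>The value \<open>lambda_rho\<close> is the same at \<open>s\<close> and
    \<open>L - s\<close> and cancels. The diffusion of \<rho> leaves a square with a good
    sign.\<close>
  have 1: "?lhs = mult + diss - 2 * \<mu> * (\<rho>s t s + \<rho>s t ?r)\<^sup>2"
    unfolding mult_def diss_def energy_rate_def evolution[OF assms(1,2)] evolution[OF assms(1) r] flux_def
    by (simp add: algebra_simps)
  have K0: "K \<ge> 0" using K(1)[OF N[OF r]] by linarith
  have 2: "diss \<le> (2 * K\<^sup>2 * M\<^sup>2 / b + K * M\<^sup>2) * (v t s)\<^sup>2"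
    unfolding diss_def v_def
    by (rule dissipation_term_bound[OF \<open>b > 0\<close> b[OF N[OF assms(2)]] _ _ K(1)[OF N[OF r]] x[OF assms(2)] x[OF r]])
      (rule deriv_bound_imp_abs_diff_le[OF smooth_real_deriv(1)[OF beta_smooth] K(1) N[OF assms(2)] N[OF r]]
        deriv_bound_imp_abs_diff_le[OF smooth_real_deriv(2)[OF beta_smooth] K(2) N[OF assms(2)] N[OF r]]; assumption)+
  have "mult \<le> 3 * (\<bar>?l1\<bar> + \<bar>?l2\<bar>) * (u t s)\<^sup>2"
    using multiplier_term_bound[of "\<theta> t s" "\<theta> t ?r" a ?l1 ?l2] by (simp add: mult_def u_def)
  also have "\<dots> \<le> 3 * \<Lambda> * (u t s)\<^sup>2"
    using l by (intro mult_right_mono) auto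
  finally have 3: "mult \<le> 3 * \<Lambda> * (u t s)\<^sup>2" .
  have "2 * K\<^sup>2 * M\<^sup>2 / b + K * M\<^sup>2 \<ge> 0" "3 * \<Lambda> \<ge> 0"
    using K0 \<open>b > 0\<close> l by auto
  then have "(2 * K\<^sup>2 * M\<^sup>2 / b + K * M\<^sup>2) * (u t s)\<^sup>2 \<ge> 0" "3 * \<Lambda> * (v t s)\<^sup>2 \<ge> 0"
    by (auto intro: mult_nonneg_nonneg)
  \<comment> \<open>Adding the nonnegative cross terms gives both squares the same
    coefficient.\<close>
  with 2 3 have "mult + diss \<le> (2 * K\<^sup>2 * M\<^sup>2 / b + K * M\<^sup>2 + 3 * \<Lambda>) * ((u t s)\<^sup>2 + (v t s)\<^sup>2)"
    unfolding distrib_left distrib_right by linarith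
  moreover have "2 * \<mu> * (\<rho>s t s + \<rho>s t ?r)\<^sup>2 \<ge> 0"
    using mu_pos by simp
  ultimately show ?thesis unfolding 1 by linarith
qed

text \<open>All subtracted terms integrate to zero; \<open>k\<close> does not depend on
  \<open>s\<close>, so it leaves the integral.\<close>

lemma integrated_energy_rate_bound:
  assumes "t > 0"
    and bound: "\<And>s. s \<in> {0..L} \<Longrightarrow> energy_rate t s
      - 2 * ((\<theta>s t s - \<theta>s t (L - s)) * (flux t s - flux t (L - s))
         + u t s * (arc_deriv L (flux t) s + arc_deriv L (flux t) (L - s)))
      - 2 * \<mu> * ((\<rho>s t s + \<rho>s t (L - s))\<^sup>2
         + v t s * (arc_deriv L (\<rho>s t) s - arc_deriv L (\<rho>s t) (L - s)))
      - k * (sin (\<theta> t s - a) + sin (\<theta> t (L - s) - a))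
    \<le> C * ((u t s)\<^sup>2 + (v t s)\<^sup>2)" (is "\<And>s. _ \<Longrightarrow> energy_rate t s - 2 * ?U s - 2 * \<mu> * ?V s - k * ?W s \<le> _")
  shows "integral {0..L} (energy_rate t) \<le> C * energy t"
proof -
  have U: "(?U has_integral 0) {0..L}"
  proof -
    have "(?U has_integral u t L * (flux t L - flux t (L - L)) - u t 0 * (flux t 0 - flux t (L - 0))) {0..L}"
    proof (rule has_integral_derivative)
      fix s assume s: "s \<in> {0..L}"
      then have r: "L - s \<in> {0..L}" by auto
      show "((\<lambda>s. u t s * (flux t s - flux t (L - s))) has_real_derivative ?U s) (at s within {0..L})"
        unfolding u_def
        by (rule derivative_eq_intros theta_derivs(2)[OF assms(1) s] flux_deriv[OF assms(1) s]
            has_real_derivative_reflect[OF s theta_derivs(2)[OF assms(1) r]]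
            has_real_derivative_reflect[OF s flux_deriv[OF assms(1) r]] refl | simp)+
    qed (use L_pos in auto)
    \<comment> \<open>At both endpoints the second factor is a difference of \<open>flux t L\<close>
      and \<open>flux t 0\<close>.\<close>
    then show ?thesis using periodic[OF assms(1)] by simp
  qed
  have V: "(?V has_integral 0) {0..L}"
  proof -
    have "(?V has_integral v t L * (\<rho>s t L + \<rho>s t (L - L)) - v t 0 * (\<rho>s t 0 + \<rho>s t (L - 0))) {0..L}"
    proof (rule has_integral_derivative)
      fix s assume s: "s \<in> {0..L}"
      then have r: "L - s \<in> {0..L}" by auto
      show "((\<lambda>s. v t s * (\<rho>s t s + \<rho>s t (L - s))) has_real_derivative ?V s) (at s within {0..L})"
        unfolding v_def
        by (rule derivative_eq_intros rho_derivs(2,3)[OF assms(1) s]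
            has_real_derivative_reflect[OF s rho_derivs(2)[OF assms(1) r]]
            has_real_derivative_reflect[OF s rho_derivs(3)[OF assms(1) r]] refl | simp add: power2_eq_square)+
    qed (use L_pos in auto)
    \<comment> \<open>Periodicity of \<rho> makes \<open>v t\<close> vanish at both
      endpoints.\<close>
    then show ?thesis using periodic[OF assms(1)] by (simp add: v_def)
  qed
  \<comment> \<open>Closedness with phase \<open>a\<close>, added to its own reflection.\<close>
  have W: "(?W has_integral 0) {0..L}"
    using has_integral_add[OF integral_sin_zero[OF assms(1), of a]
        integral_reflect_interval[OF integral_sin_zero[OF assms(1), of a]]] by simp
  have "((\<lambda>s. energy_rate t s - 2 * ?U s - 2 * \<mu> * ?V s - k * ?W s) has_integral
      integral {0..L} (energy_rate t) - 2 * 0 - 2 * \<mu> * 0 - k * 0) {0..L}"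
    by (intro has_integral_diff has_integral_mult_right energy_deriv(2) U V W assms(1))
  moreover have "((\<lambda>s. C * ((u t s)\<^sup>2 + (v t s)\<^sup>2)) has_integral C * energy t) {0..L}"
    unfolding energy_def using assms(1)
    by (intro has_integral_mult_right integrable_integral integrable_continuous_real
        continuous_intros continuous_on_u_v) auto
  ultimately have "integral {0..L} (energy_rate t) - 2 * 0 - 2 * \<mu> * 0 - k * 0 \<le> C * energy t"
    using bound by (rule has_integral_le)
  then show ?thesis by simp
qed

text \<open>Compactness of the cylinder over \<open>{0..T}\<close> provides constants that are
  uniform in time, including times close to 0.\<close>

lemma energy_rate_linear_bound:
  obtains C where "\<And>t. \<lbrakk>0 < t; t < T\<rbrakk> \<Longrightarrow> integral {0..L} (energy_rate t) \<le> C * energy t"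
proof -
  let ?S = "{0..T} \<times> {0..L}"
  have S: "compact ?S" by (intro compact_Times) auto
  have c: "continuous_on ?S (\<lambda>x. \<theta>s (fst x) (snd x) - c0)" "continuous_on ?S (\<lambda>x. \<rho> (fst x) (snd x))"
    by (intro continuous_intros continuous_on_state; auto)+
  obtain M where M: "\<And>x. x \<in> ?S \<Longrightarrow> \<bar>\<theta>s (fst x) (snd x) - c0\<bar> \<le> M"
    by (rule continuous_on_compact_bound[OF S c(1)]) (rule that)
  obtain N0 where N0: "\<And>x. x \<in> ?S \<Longrightarrow> \<bar>\<rho> (fst x) (snd x)\<bar> \<le> N0"
    by (rule continuous_on_compact_bound[OF S c(2)]) (rule that)
  \<comment> \<open>The maximum with 0 keeps \<open>{-N..N}\<close> nonempty, so \<beta> attains a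
    minimum there; its positive value serves as the coercivity constant \<open>b\<close>.\<close>
  define N where "N = max 0 N0"
  have sub: "continuous_on {-N..N} f" if "continuous_on UNIV f" for f :: "real \<Rightarrow> real"
    using that by (rule continuous_on_subset) simp
  obtain K1 where K1: "\<And>y. y \<in> {-N..N} \<Longrightarrow> \<bar>deriv \<beta> y\<bar> \<le> K1"
    by (rule continuous_on_compact_bound[OF compact_Icc sub[OF smooth_real_deriv(4)[OF beta_smooth]]]) (rule that)
  obtain K2 where K2: "\<And>y. y \<in> {-N..N} \<Longrightarrow> \<bar>deriv (deriv \<beta>) y\<bar> \<le> K2"
    by (rule continuous_on_compact_bound[OF compact_Icc sub[OF smooth_real_deriv(5)[OF beta_smooth]]]) (rule that)
  have "{-N..N} \<noteq> {}" by (simp add: N_def)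
  then obtain y0 where y0: "\<And>y. y \<in> {-N..N} \<Longrightarrow> \<beta> y0 \<le> \<beta> y"
    using continuous_attains_inf[OF compact_Icc _ sub[OF smooth_real_deriv(3)[OF beta_smooth]]] by blast
  have "continuous_on {0..T} (\<lambda>t. \<bar>multiplier t $ 1\<bar> + \<bar>multiplier t $ 2\<bar>)"
    by (rule continuous_on_subset[of "{0..}"]) (auto intro!: continuous_on_add continuous_on_rabs continuous_on_multiplier)
  then obtain \<Lambda> where \<Lambda>: "\<And>t. t \<in> {0..T} \<Longrightarrow> \<bar>\<bar>multiplier t $ 1\<bar> + \<bar>multiplier t $ 2\<bar>\<bar> \<le> \<Lambda>"
    using continuous_on_compact_bound[OF compact_Icc] by meson
  define K where "K = max K1 K2"
  show ?thesis
  proof (rule that)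
    fix t assume t: "0 < t" "t < T"
    show "integral {0..L} (energy_rate t) \<le> (2 * K\<^sup>2 * M\<^sup>2 / \<beta> y0 + K * M\<^sup>2 + 3 * \<Lambda>) * energy t"
    proof (rule integrated_energy_rate_bound[OF t(1)], rule energy_rate_bound[where N = N])
      show "\<bar>\<theta>s t s - c0\<bar> \<le> M" "\<bar>\<rho> t s\<bar> \<le> N" if "s \<in> {0..L}" for s
        using M[of "(t, s)"] N0[of "(t, s)"] that t by (auto simp: N_def)
      show "\<beta> y0 \<le> \<beta> y" "\<bar>deriv \<beta> y\<bar> \<le> K" "\<bar>deriv (deriv \<beta>) y\<bar> \<le> K" if "\<bar>y\<bar> \<le> N" for y
      proof -
        have "y \<in> {-N..N}" using that by (simp add: abs_le_iff)
        then show "\<beta> y0 \<le> \<beta> y" "\<bar>deriv \<beta> y\<bar> \<le> K" "\<bar>deriv (deriv \<beta>) y\<bar> \<le> K"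
          using y0 K1 K2 by (auto simp: K_def le_max_iff_disj)
      qed
      show "\<bar>multiplier t $ 1\<bar> + \<bar>multiplier t $ 2\<bar> \<le> \<Lambda>"
        using \<Lambda>[of t] t by simp
    qed (use t beta_pos in auto)
  qed
qed

section \<open>Vanishing of the defect and symmetry at positive times\<close>

text \<open>Gronwall's lemma gives \<open>energy t \<le> 0\<close>; a continuous nonnegative
  integrand with zero integral vanishes pointwise.\<close>

lemma reflection_invariant:
  assumes "t > 0" "s \<in> {0..L}"
  shows "\<theta> t s = 2 * a - \<theta> t (L - s)" "\<rho> t s = \<rho> t (L - s)"
proof -
  obtain C where C: "\<And>r. \<lbrakk>0 < r; r < t\<rbrakk> \<Longrightarrow> integral {0..L} (energy_rate r) \<le> C * energy r"
    using energy_rate_linear_bound[of t] by blast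
  have "u 0 s = 0" "v 0 s = 0" if "s \<in> {0..L}" for s
    using initial_symmetric[OF that] by (simp_all add: u_def v_def)
  then have "energy 0 = integral {0..L} (\<lambda>s. 0)"
    unfolding energy_def by (intro integral_cong) simp
  then have "energy t \<le> 0"
    using assms(1) C energy_deriv(1) continuous_on_subset[OF continuous_on_energy, of "{0..t}"]
    by (intro gronwall_zero[of t energy "\<lambda>r. integral {0..L} (energy_rate r)" C]) auto
  moreover have c: "continuous_on {0..L} (\<lambda>s. (u t s)\<^sup>2 + (v t s)\<^sup>2)"
    using assms(1) by (intro continuous_intros continuous_on_u_v) auto
  moreover have "energy t \<ge> 0"
    unfolding energy_def by (intro integral_nonneg integrable_continuous_real c) auto
  ultimately have "(u t s)\<^sup>2 + (v t s)\<^sup>2 = 0"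
    using integral_eq_0_iff[OF c L_pos] assms(2) by (simp add: energy_def)
  then show "\<theta> t s = 2 * a - \<theta> t (L - s)" "\<rho> t s = \<rho> t (L - s)"
    by (simp_all add: sum_power2_eq_zero_iff u_def v_def)
qed

text \<open>Differentiating the reflection identity for \<theta> produces two minus signs, which
  cancel.\<close>

lemma axially_symmetric_flow:
  assumes "t > 0"
  shows "axially_symmetric L (\<theta> t) (\<rho> t)"
  unfolding axially_symmetric_def
proof (intro conjI ballI)
  fix s assume s: "s \<in> {0..L}"
  then have r: "L - s \<in> {0..L}" by auto
  show "\<rho> t s = \<rho> t (L - s)" by (rule reflection_invariant[OF assms s])
  have "((\<lambda>s. 2 * a - \<theta> t (L - s)) has_real_derivative \<theta>s t (L - s)) (at s within {0..L})"
    by (rule derivative_eq_intros has_real_derivative_reflect[OF s theta_derivs(2)[OF assms r]] refl | simp)+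
  \<comment> \<open>The identity holds on all of \<open>{0..L}\<close>, so the neighbourhood radius
    1 is an arbitrary choice.\<close>
  then have "(\<theta> t has_real_derivative \<theta>s t (L - s)) (at s within {0..L})"
    by (rule has_field_derivative_transform_within[OF _ zero_less_one s])
      (rule reflection_invariant(1)[OF assms, symmetric])
  then show "\<theta>s t s = \<theta>s t (L - s)"
    by (rule arc_deriv_unique[OF L_pos s])
qed (use smooth_cylinder_slice cylinder assms in auto)

end

section \<open>Reduction to the symmetric setting\<close>

theorem proposition3p19:
  fixes L \<nu> \<mu> c0 :: real and \<omega> :: int and \<beta> :: "real \<Rightarrow> real"
    and \<theta>0 \<rho>0 :: "real \<Rightarrow> real" and \<theta> \<rho> :: "real \<Rightarrow> real \<Rightarrow> real"
  assumes "L > 0" and "\<mu> > 0"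
    and "smooth_real \<beta>" and "\<And>x. \<beta> x > 0"
    and "\<omega> = 1"
    and "admissible L \<nu> \<omega> \<theta>0 \<rho>0"
    and "flow_solution L \<mu> \<omega> c0 \<beta> \<theta>0 \<rho>0 \<theta> \<rho>"
    and "axially_symmetric L \<theta>0 \<rho>0"
  shows "\<forall>t>0. axially_symmetric L (\<theta> t) (\<rho> t)"
proof -
  have initial: "\<theta> 0 s = \<theta>0 s" "\<rho> 0 s = \<rho>0 s" if "s \<in> {0..L}" for s
    using assms(7) that by (auto simp: flow_solution_def)
  have reflect: "L - s \<in> {0..L}" if "s \<in> {0..L}" for s
    using that by auto
  have deriv: "(\<theta>0 has_real_derivative arc_deriv L \<theta>0 s) (at s within {0..L})" if "s \<in> {0..L}" for s
    using assms(6) that unfolding admissible_def smooth_interval_def differentiable_on_def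
    by (intro arc_deriv_has_derivative) (metis funpow_0)
  \<comment> \<open>Axial symmetry only concerns the derivative of \<open>\<theta>0\<close>;
    integrating it yields the constant \<open>c\<close>, and \<open>a\<close> becomes
    \<open>c / 2\<close>.\<close>
  have "((\<lambda>s. \<theta>0 s + \<theta>0 (L - s)) has_real_derivative 0) (at s within {0..L})" if s: "s \<in> {0..L}" for s
  proof -
    have "arc_deriv L \<theta>0 s = arc_deriv L \<theta>0 (L - s)"
      using assms(8) s unfolding axially_symmetric_def by blast
    then show ?thesis
      using DERIV_add[OF deriv[OF s] has_real_derivative_reflect[OF s deriv[OF reflect[OF s]]]] by simp
  qed
  then obtain c where c: "\<And>s. s \<in> {0..L} \<Longrightarrow> \<theta>0 s + \<theta>0 (L - s) = c"
    using has_field_derivative_zero_constant[of "{0..L}" "\<lambda>s. \<theta>0 s + \<theta>0 (L - s)"] by auto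
  have rho0: "\<rho>0 s = \<rho>0 (L - s)" if "s \<in> {0..L}" for s
    using assms(8) that unfolding axially_symmetric_def by blast
  have "integral {0..L} (\<lambda>s. sin (\<theta> 0 s)) = integral {0..L} (\<lambda>s. sin (\<theta>0 s))"
    "integral {0..L} (\<lambda>s. cos (\<theta> 0 s)) = integral {0..L} (\<lambda>s. cos (\<theta>0 s))"
    by (rule integral_cong; simp add: initial)+
  \<comment> \<open>\<open>flow_solution\<close> sees the initial data only through their values on
    \<open>{0..L}\<close>, so the slices at time 0 may replace them.\<close>
  moreover have "flow_solution L \<mu> 1 c0 \<beta> (\<theta> 0) (\<rho> 0) \<theta> \<rho>"
    using assms(5,7) by (simp add: flow_solution_def)
  ultimately interpret symmetric_flow L \<mu> c0 "c / 2" \<beta> \<theta> \<rho>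
  proof unfold_locales
    show "\<rho> 0 s = \<rho> 0 (L - s)" if "s \<in> {0..L}" for s
      using rho0[OF that] initial(2)[OF that] initial(2)[OF reflect[OF that]] by metis
  qed (use assms(1-6) c reflect in \<open>auto simp: initial admissible_def\<close>)
  show ?thesis using axially_symmetric_flow by blast
qed

end
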